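(* The inequality $$\sup_{I\in\mathcal{S}}\ \min\bigl(C(P_I),\,C(P_I^\perp)\bigr)\le \sup_{I\in\mathcal{S}} C(P_I)$$ can be strict; that is, there exists a polynomial $P\in\mathbb{H}[x]$ such that $$\sup_{I\in\mathcal{S}}\ \min\bigl(C(P_I),\,C(P_I^\perp)\bigr)< \sup_{I\in\mathcal{S}} C(P_I).$$
   Context: $\mathbb{H}$ is the real algebra of quaternions $h=\alpha_0+\alpha_1 i+\alpha_2 j+\alpha_3 k$ with $i^2=j^2=k^2=ijk=-1$, with $\mathrm{Re}(h)=\alpha_0$ and absolute value $|h|=\sqrt{\alpha_0^2+\alpha_1^2+\alpha_2^2+\alpha_3^2}$, equipped with the standard Euclidean scalar product on $\mathbb{R}^4$ in the basis $1,i,j,k$. $\mathcal{S}=\{h\in\mathbb{H} : |h|=1,\ \mathrm{Re}(h)=0\}$. For $I\in\mathcal{S}$, $\mathbb{R}[I]=\{a+Ib : a,b\in\mathbb{R}\}$. A polynomial in $\mathbb{H}[x]$ is a formal expression $P(x)=\sum_{t=0}^n a_t x^t$ with $a_t\in\mathbb{H}$ (coefficients on the left). For $I\in\mathcal{S}$ let $b_t$ be the orthogonal projection of $a_t$ on $\mathbb{R}[I]$ and $b_t^\perp=a_t-b_t$. Put $P_I(x)=\sum_t b_t x^t$ and $P_I^\perp(x)=\sum_t b_t^\perp x^t$. The function $C:\mathbb{H}[x]\to\mathbb{R}\cup\{+\infty\}$ is defined by $C(F)=+\infty$ if $F$ is constant, and, for $F(x)=\sum_{t=0}^m c_t x^t$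 with $m\ge1$ and $c_m\ne0$, by $C(F)=|c_m|^{-1}\sqrt{\sum_{t=0}^m|c_t|^2}$. *)

theory Defs
  imports
    "HOL-Analysis.Analysis"
    "HOL-Computational_Algebra.Polynomial"
begin

text \<open>\<open>Quat a b c d\<close> stands for \<open>a + b i + c j + d k\<close>.\<close>

datatype quat = Quat (qre: real) (qim1: real) (qim2: real) (qim3: real)

lemma quat_eq_iff:
  "x = y \<longleftrightarrow> qre x = qre y \<and> qim1 x = qim1 y \<and> qim2 x = qim2 y \<and> qim3 x = qim3 y"
  by (cases x; cases y) simp

instantiation quat :: ring_1
begin

definition "0 = Quat 0 0 0 0"
definition "1 = Quat 1 0 0 0"
definition "x + y = Quat (qre x + qre y) (qim1 x + qim1 y) (qim2 x + qim2 y) (qim3 x + qim3 y)"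
definition "- x = Quat (- qre x) (- qim1 x) (- qim2 x) (- qim3 x)"
definition "x - y = Quat (qre x - qre y) (qim1 x - qim1 y) (qim2 x - qim2 y) (qim3 x - qim3 y)"
definition "x * y = Quat
  (qre x * qre y - qim1 x * qim1 y - qim2 x * qim2 y - qim3 x * qim3 y)
  (qre x * qim1 y + qim1 x * qre y + qim2 x * qim3 y - qim3 x * qim2 y)
  (qre x * qim2 y - qim1 x * qim3 y + qim2 x * qre y + qim3 x * qim1 y)
  (qre x * qim3 y + qim1 x * qim2 y - qim2 x * qim1 y + qim3 x * qre y)"

instance
proof
  fix x y z :: quat
  show "x * y * z = x * (y * z)"
    unfolding quat_eq_iff times_quat_def quat.sel by (intro conjI; algebra)
  show "(x + y) * z = x * z + y * z" "x * (y + z) = x * y + x * z"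
    unfolding quat_eq_iff times_quat_def plus_quat_def quat.sel by (intro conjI; algebra)+
qed (simp_all add: zero_quat_def one_quat_def plus_quat_def uminus_quat_def minus_quat_def
      times_quat_def)

end

instantiation quat :: real_algebra_1
begin

definition "r *\<^sub>R x = Quat (r * qre x) (r * qim1 x) (r * qim2 x) (r * qim3 x)"

instance
  by standard (simp_all add: scaleR_quat_def plus_quat_def times_quat_def algebra_simps)

end

definition qi :: quat where "qi = Quat 0 1 0 0"
definition qj :: quat where "qj = Quat 0 0 1 0"
definition qk :: quat where "qk = Quat 0 0 0 1"

lemma quat_relations:
  "qi * qi = - 1" "qj * qj = - 1" "qk * qk = - 1" "qi * qj * qk = - 1"
  by (simp_all add: qi_def qj_def qk_def times_quat_def one_quat_def uminus_quat_def)

lemma quat_expansion: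
  "Quat a b c d = of_real a + b *\<^sub>R qi + c *\<^sub>R qj + d *\<^sub>R qk"
  by (simp add: of_real_def qi_def qj_def qk_def plus_quat_def scaleR_quat_def one_quat_def)

instantiation quat :: real_inner
begin

definition "inner x y = qre x * qre y + qim1 x * qim1 y + qim2 x * qim2 y + qim3 x * qim3 y"
definition "norm x = sqrt ((qre x)\<^sup>2 + (qim1 x)\<^sup>2 + (qim2 x)\<^sup>2 + (qim3 x)\<^sup>2)"
definition "sgn x = x /\<^sub>R norm (x :: quat)"
definition "dist x y = norm (x - y :: quat)"
definition [code del]:
  "(uniformity :: (quat \<times> quat) filter) = (INF e\<in>{0 <..}. principal {(x, y). dist x y < e})"
definition [code del]:
  "open (U :: quat set) \<longleftrightarrow> (\<forall>x\<in>U. eventually (\<lambda>(x', y). x' = x \<longrightarrow> y \<in> U) uniformity)"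

instance
proof
  fix x y z :: quat and r :: real
  show "inner x y = inner y x"
    by (simp add: inner_quat_def mult.commute)
  show "inner (x + y) z = inner x z + inner y z"
    by (simp add: inner_quat_def plus_quat_def distrib_right)
  show "inner (r *\<^sub>R x) y = r * inner x y"
    by (simp add: inner_quat_def scaleR_quat_def distrib_left mult.assoc)
  show "0 \<le> inner x x"
    by (simp add: inner_quat_def)
  show "inner x x = 0 \<longleftrightarrow> x = 0"
    by (simp add: inner_quat_def zero_quat_def quat_eq_iff add_nonneg_eq_0_iff)
  show "norm x = sqrt (inner x x)"
    by (simp add: inner_quat_def norm_quat_def power2_eq_square)
qed (rule sgn_quat_def dist_quat_def uniformity_quat_def open_quat_def)+

end

instantiation quat :: euclidean_space
begin

definition "Basis = {1, qi, qj, qk}"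

instance
proof
  show "(Basis :: quat set) \<noteq> {}" "finite (Basis :: quat set)"
    by (simp_all add: Basis_quat_def)
  show "inner u v = (if u = v then 1 else 0)" if "u \<in> Basis" "v \<in> Basis" for u v :: quat
    using that unfolding Basis_quat_def
    by (elim insertE emptyE) (simp_all add: inner_quat_def one_quat_def qi_def qj_def qk_def)
  show "(\<forall>u\<in>Basis. inner x u = 0) \<longleftrightarrow> x = 0" for x :: quat
    by (simp add: Basis_quat_def inner_quat_def one_quat_def qi_def qj_def qk_def
        quat_eq_iff[of x] zero_quat_def)
qed

end

definition imag_units :: "quat set" where
  "imag_units = {h. norm h = 1 \<and> qre h = 0}"

definition slice :: "quat \<Rightarrow> quat set" where
  "slice I = {of_real a + I * of_real b | a b. True}"

definition slice_proj :: "quat \<Rightarrow> quat \<Rightarrow> quat" where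
  "slice_proj I a = (THE b. b \<in> slice I \<and> (\<forall>y\<in>slice I. orthogonal (a - b) y))"

lemma slice_eq: "slice I = {a *\<^sub>R 1 + b *\<^sub>R I | a b. True}"
  by (simp add: slice_def of_real_def)

lemma imag_units_inner:
  assumes "I \<in> imag_units"
  shows "inner I I = 1" "inner 1 I = 0" "inner I 1 = 0" "inner (1 :: quat) 1 = 1"
proof -
  show "inner I I = 1"
    using assms by (simp add: imag_units_def dot_square_norm)
qed (use assms in \<open>simp_all add: imag_units_def inner_quat_def one_quat_def\<close>)

lemma slice_proj_eqI:
  assumes "b \<in> slice I" and "\<And>y. y \<in> slice I \<Longrightarrow> orthogonal (a - b) y"
  shows "slice_proj I a = b"
  unfolding slice_proj_def
proof (rule the_equality)
  fix c assume c: "c \<in> slice I \<and> (\<forall>y\<in>slice I. orthogonal (a - c) y)"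
  obtain p q r s where bc: "b = p *\<^sub>R 1 + q *\<^sub>R I" "c = r *\<^sub>R 1 + s *\<^sub>R I"
    using assms(1) c by (auto simp: slice_eq)
  have "c - b = (r - p) *\<^sub>R 1 + (s - q) *\<^sub>R I"
    by (simp add: bc algebra_simps)
  then have "c - b \<in> slice I"
    by (auto simp: slice_eq)
  then have "inner (a - b) (c - b) = 0" "inner (a - c) (c - b) = 0"
    using assms(2) c by (auto simp: orthogonal_def)
  then have "inner (c - b) (c - b) = 0"
    by (simp add: inner_diff_left)
  then show "c = b"
    by simp
qed (use assms in auto)

lemma slice_proj_eq:
  assumes "I \<in> imag_units"
  shows "slice_proj I a = of_real (inner a 1) + inner a I *\<^sub>R I"
  by (rule slice_proj_eqI)
    (auto simp: slice_eq of_real_def orthogonal_def imag_units_inner[OF assms]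
      inner_diff_left inner_add_left inner_add_right)

lemma slice_proj_0 [simp]:
  "slice_proj I 0 = 0"
proof (rule slice_proj_eqI)
  show "0 \<in> slice I"
    unfolding slice_eq by (intro CollectI exI[of _ 0]) simp
qed (simp add: orthogonal_def)

definition poly_slice :: "quat \<Rightarrow> quat poly \<Rightarrow> quat poly" where
  "poly_slice I P = map_poly (slice_proj I) P"

definition poly_slice_perp :: "quat \<Rightarrow> quat poly \<Rightarrow> quat poly" where
  "poly_slice_perp I P = map_poly (\<lambda>a. a - slice_proj I a) P"

lemma coeff_poly_slice:
  "coeff (poly_slice I P) t = slice_proj I (coeff P t)"
  "coeff (poly_slice_perp I P) t = coeff P t - slice_proj I (coeff P t)"
  by (simp_all add: poly_slice_def poly_slice_perp_def coeff_map_poly)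

text \<open>The zero polynomial has degree \<open>0\<close> and counts as constant.\<close>

definition poly_C :: "quat poly \<Rightarrow> ereal" where
  "poly_C F = (if degree F = 0 then \<infinity>
     else ereal (inverse (norm (lead_coeff F)) * sqrt (\<Sum>t\<le>degree F. (norm (coeff F t))\<^sup>2)))"

end

theory Submission
  imports Defs
begin

text \<open>For \<open>P = i x\<close> both \<open>P\<^sub>I\<close> and its orthogonal counterpart are monomials, and a nonconstant
  monomial has \<open>C = 1\<close>. Their coefficients add up to \<open>i \<noteq> 0\<close>, so at least one of the two
  is nonconstant and the minimum is \<open>1\<close> for every \<open>I\<close>. But \<open>P\<^sub>I = 0\<close> for \<open>I = j\<close>, so
  the supremum on the right is infinite.\<close>

text \<open>A single nonzero coefficient gives
  \<open>inverse (norm c) * sqrt ((norm c)\<^sup>2) = 1\<close>. For \<open>c = 0\<close> the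
  monomial collapses to the zero polynomial, of degree 0.\<close>

lemma poly_C_monom:
  assumes "n > 0"
  shows "poly_C (monom c n) = (if c = 0 then \<infinity> else 1)"
proof (cases "c = 0")
  case False
  have "(\<Sum>t\<le>n. (norm (coeff (monom c n) t))\<^sup>2) = (\<Sum>t\<le>n. if n = t then (norm c)\<^sup>2 else 0)"
    by (rule sum.cong) auto
  then have "(\<Sum>t\<le>n. (norm (coeff (monom c n) t))\<^sup>2) = (norm c)\<^sup>2"
    by simp
  then show ?thesis
    using False assms by (simp add: poly_C_def degree_monom_eq one_ereal_def)
qed (simp add: poly_C_def)

text \<open>Both coefficient maps fix 0, so no new terms appear.\<close>

lemma poly_slice_monom:
  "poly_slice I (monom a n) = monom (slice_proj I a) n"
  "poly_slice_perp I (monom a n) = monom (a - slice_proj I a) n"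
  by (simp_all add: poly_slice_def poly_slice_perp_def map_poly_monom)

theorem proposition5p4:
  shows "\<exists>P :: quat poly.
    (SUP I\<in>imag_units. min (poly_C (poly_slice I P)) (poly_C (poly_slice_perp I P)))
      < (SUP I\<in>imag_units. poly_C (poly_slice I P))"
proof
  let ?P = "monom qi 1"
  have "qi \<noteq> 0"
    by (simp add: qi_def zero_quat_def)
  then have "min (poly_C (poly_slice I ?P)) (poly_C (poly_slice_perp I ?P)) \<le> 1" for I
    by (simp add: poly_slice_monom poly_C_monom min_le_iff_disj)
  then have "(SUP I\<in>imag_units. min (poly_C (poly_slice I ?P)) (poly_C (poly_slice_perp I ?P))) \<le> 1"
    by (rule SUP_least)
  also have "1 < (\<infinity> :: ereal)"
    by simp
  also have "\<infinity> = poly_C (poly_slice qj ?P)"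
  proof -
    have "qj \<in> imag_units"
      by (simp add: imag_units_def qj_def norm_quat_def)
    \<comment> \<open>\<open>qi\<close> is orthogonal to \<open>1\<close> and \<open>qj\<close>,
      which span \<open>slice qj\<close>.\<close>
    then have "slice_proj qj qi = 0"
      by (simp add: slice_proj_eq inner_quat_def one_quat_def qi_def qj_def)
    \<comment> \<open>The projected polynomial is zero, hence counts as constant.\<close>
    then show ?thesis
      by (simp add: poly_slice_monom poly_C_def)
  qed
  also have "\<dots> \<le> (SUP I\<in>imag_units. poly_C (poly_slice I ?P))"
    by (rule SUP_upper) (simp add: imag_units_def qj_def norm_quat_def)
  finally show "(SUP I\<in>imag_units. min (poly_C (poly_slice I ?P)) (poly_C (poly_slice_perp I ?P)))
      < (SUP I\<in>imag_units. poly_C (poly_slice I ?P))" .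
qed

end
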